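(* Let $k$ be a positive integer. The maximum possible value of $n$ for which some simple connected graph of edge metric dimension at most $k$ contains the star $K_{1,n}$ as a subgraph is $n = 2^{k}$.
   Context: All graphs are simple and connected. For vertices $u,v$ of a graph $G$, $d(u,v)$ is their distance in $G$. For an edge $e=\{x,y\}$ and a vertex $v$, let $d(e,v)=\min(d(x,v),d(y,v))$. A set $S\subset V(G)$ is a resolving set for the edges of $G$ if no two distinct edges $e,f$ satisfy $d(e,s)=d(f,s)$ for all $s\in S$. The edge metric dimension $\operatorname{edim}(G)$ is the minimum size of a resolving set for the edges of $G$. Subgraphs are not required to be induced. *)

theory Defs
  imports "Graph_Theory.Graph_Theory" "HOL-Library.Extended_Nat"
begin

text \<open>
  Graphs are irreflexive symmetric relations: \<^locale>\<open>pair_bidirected_digraph\<close> is the locale of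
  simple graphs with a possibly infinite vertex set, and \<^locale>\<open>pair_graph\<close> adds finiteness.
  An undirected edge is a pair of opposite arcs, represented by its set of two endpoints.
\<close>

definition uedges :: "'a pair_pre_digraph \<Rightarrow> 'a set set" where
  "uedges G = {{x, y} | x y. (x, y) \<in> parcs G}"

definition vdist :: "'a pair_pre_digraph \<Rightarrow> 'a \<Rightarrow> 'a \<Rightarrow> ereal" where
  "vdist G u v = wf_digraph.\<mu> (with_proj G) (\<lambda>_. 1) u v"

definition edge_dist :: "'a pair_pre_digraph \<Rightarrow> 'a set \<Rightarrow> 'a \<Rightarrow> ereal" where
  "edge_dist G e v = Min ((\<lambda>x. vdist G x v) ` e)"

definition edge_resolving :: "'a pair_pre_digraph \<Rightarrow> 'a set \<Rightarrow> bool" where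
  "edge_resolving G S \<longleftrightarrow> S \<subseteq> pverts G \<and>
     \<not> (\<exists>e \<in> uedges G. \<exists>f \<in> uedges G. e \<noteq> f \<and> (\<forall>s \<in> S. edge_dist G e s = edge_dist G f s))"

text \<open>
  Sizes are extended naturals because an infinite graph may have no finite resolving set. The
  vertex set of a simple connected graph always resolves its edges, and \<^typ>\<open>enat\<close> is well-ordered,
  so the infimum is a minimum.
\<close>

definition edim :: "'a pair_pre_digraph \<Rightarrow> enat" where
  "edim G = (INF S \<in> {S. edge_resolving G S}. if finite S then enat (card S) else \<infinity>)"

definition contains_star :: "'a pair_pre_digraph \<Rightarrow> nat \<Rightarrow> bool" where
  "contains_star G n \<longleftrightarrow>
     (\<exists>H :: 'a pair_pre_digraph. complete_bipartite_digraph 1 n (with_proj H)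
        \<and> subgraph (with_proj H) (with_proj G))"

end

theory Submission
  imports Defs
begin

text \<open>
  \<^emph>\<open>Upper bound.\<close> Let \<open>c\<close> be the centre of a star and \<open>s\<close> a member of a resolving set \<open>S\<close>. The distances
  of adjacent vertices to \<open>s\<close> differ by at most one, so every edge \<open>{c, v}\<close> has distance \<open>d(c, s)\<close> or
  \<open>d(c, s) - 1\<close> to \<open>s\<close>. Recording for which \<open>s \<in> S\<close> the second case occurs assigns to each leaf a subset
  of \<open>S\<close>, and distinct leaves get distinct subsets because \<open>S\<close> resolves the edges (\<open>star_leaves_le\<close>).

  \<^emph>\<open>Construction.\<close> All \<open>2\<^sup>k\<close> patterns occur when the leaves are the \<open>k\<close>-bit strings and there is one
  landmark per bit position, adjacent to exactly the strings in which that bit is set. If \<open>b\<close> is a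
  string and \<open>x\<close> is a landmark or the centre, then an edge \<open>{x, b}\<close> has distance 0 to the landmark
  \<open>x\<close> itself (when \<open>x\<close> is one), and its distance to any other landmark is 1 or 2 according to whether
  the corresponding bit of \<open>b\<close> is set (\<open>edge_dist_bit_graph\<close>). Thus the zeros determine \<open>x\<close>, and the
  remaining distances determine \<open>b\<close>: if \<open>x\<close> is a landmark, its own bit of \<open>b\<close> is set by adjacency. Hence
  the \<open>k\<close> landmarks resolve all edges, not only those of the star.
\<close>

section \<open>Distances in graphs with unit weights\<close>

context pair_wf_digraph
begin

lemma awalk_cost_one: "awalk_cost (\<lambda>_. 1) p = real (length p)"
  by (induction p) auto

lemma vdist_conv_length: "vdist G u v = (INF p \<in> {p. awalk u p v}. ereal (real (length p)))"
  by (simp add: vdist_def \<mu>_def awalk_cost_one)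

lemma vdist_le_length: "awalk u p v \<Longrightarrow> vdist G u v \<le> ereal (real (length p))"
  unfolding vdist_conv_length by (auto intro: INF_lower)

lemma vdist_cases:
  obtains (unreachable) "vdist G u v = \<infinity>"
  | (shortest) p where "awalk u p v" "vdist G u v = ereal (real (length p))"
proof (cases "\<exists>p. awalk u p v")
  case False
  then show ?thesis
    by (intro unreachable) (simp add: vdist_conv_length top_ereal_def)
next
  case True
  then obtain q where "awalk u q v" ..
  from ex_has_least_nat[of "\<lambda>p. awalk u p v", OF this, of length]
  obtain p where p: "awalk u p v" and min: "\<And>q. awalk u q v \<Longrightarrow> length p \<le> length q"
    by blast
  have "vdist G u v = ereal (real (length p))"
  proof (rule antisym)
    show "ereal (real (length p)) \<le> vdist G u v"
      unfolding vdist_conv_length by (rule INF_greatest) (simp add: min)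
  qed (rule vdist_le_length[OF p])
  with p show ?thesis by (rule shortest)
qed

lemma vdist_arc_le:
  assumes "(x, y) \<in> parcs G"
  shows "vdist G x s \<le> vdist G y s + 1"
proof (cases rule: vdist_cases[of y s])
  case (shortest p)
  with assms have "awalk x ((x, y) # p) s"
    by (simp add: awalk_Cons_iff)
  from vdist_le_length[OF this] shortest(2) show ?thesis
    by (simp add: add.commute)
qed simp

text \<open>
  A function that decreases by at most one along every arc is a lower bound for the distance to its
  zero; following arcs along which it decreases gives a walk that attains this bound. Distances can
  thus be verified locally, without comparing walks.
\<close>

lemma vdist_eq_potential:
  fixes \<phi> :: "'a \<Rightarrow> nat"
  assumes zero: "\<And>x. x \<in> pverts G \<Longrightarrow> \<phi> x = 0 \<longleftrightarrow> x = s"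
    and slow: "\<And>x y. (x, y) \<in> parcs G \<Longrightarrow> \<phi> x \<le> \<phi> y + 1"
    and descent: "\<And>x. x \<in> pverts G \<Longrightarrow> x \<noteq> s \<Longrightarrow> \<exists>y. (x, y) \<in> parcs G \<and> \<phi> x = \<phi> y + 1"
    and s: "s \<in> pverts G" and x: "x \<in> pverts G"
  shows "vdist G x s = ereal (real (\<phi> x))"
proof (rule antisym)
  have "\<exists>p. awalk x p s \<and> length p = \<phi> x"
    using x
  proof (induction "\<phi> x" arbitrary: x)
    case 0
    then have "awalk x [] s"
      using zero by (simp add: awalk_Nil_iff)
    with 0 show ?case
      by auto
  next
    case (Suc n)
    then obtain y where y: "(x, y) \<in> parcs G" "\<phi> x = \<phi> y + 1"
      using descent zero s by (metis nat.distinct(1))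
    with Suc obtain p where "awalk y p s" "length p = \<phi> y"
      using in_arcsD2 by auto
    with y show ?case
      by (intro exI[of _ "(x, y) # p"]) (simp add: awalk_Cons_iff)
  qed
  then show "vdist G x s \<le> ereal (real (\<phi> x))"
    using vdist_le_length by fastforce
next
  have "\<phi> u \<le> length p" if "awalk u p s" for u p
    using that
  proof (induction p arbitrary: u)
    case Nil
    then show ?case
      using zero by (auto simp: awalk_Nil_iff)
  next
    case (Cons a p)
    then have "\<phi> (snd a) \<le> length p" "\<phi> u \<le> \<phi> (snd a) + 1"
      using slow[of "fst a" "snd a"] by (auto simp: awalk_Cons_iff)
    then show ?case
      by simp
  qed
  then show "ereal (real (\<phi> x)) \<le> vdist G x s"
    unfolding vdist_conv_length by (auto intro!: INF_greatest)
qed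

end

section \<open>Resolving sets and stars\<close>

lemma edge_dist_doubleton: "edge_dist G {x, y} s = min (vdist G x s) (vdist G y s)"
  by (simp add: edge_dist_def)

lemma edge_resolvingD:
  assumes "edge_resolving G S" "\<And>s. s \<in> S \<Longrightarrow> edge_dist G e s = edge_dist G f s"
    and "e \<in> uedges G" "f \<in> uedges G"
  shows "e = f"
  using assms unfolding edge_resolving_def by metis

lemma edim_leE:
  assumes "edim G \<le> enat k"
  obtains S where "edge_resolving G S" "finite S" "card S \<le> k"
proof -
  have "edim G < enat (Suc k)"
    using assms by (rule order_le_less_trans) simp
  then obtain S where "edge_resolving G S"
    and "(if finite S then enat (card S) else \<infinity>) < enat (Suc k)"
    unfolding edim_def INF_less_iff by blast
  then show ?thesis
    by (intro that[of S]) (auto split: if_splits)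
qed

lemma edim_le_card: "edge_resolving G S \<Longrightarrow> finite S \<Longrightarrow> edim G \<le> enat (card S)"
  unfolding edim_def by (rule INF_lower2[of S]) auto

lemma contains_star_iff:
  assumes "pair_wf_digraph G"
  shows "contains_star G n \<longleftrightarrow>
    (\<exists>c V. c \<notin> V \<and> finite V \<and> card V = n \<and> c \<in> pverts G \<and> V \<subseteq> pverts G
       \<and> {c} \<times> V \<union> V \<times> {c} \<subseteq> parcs G)" (is "_ \<longleftrightarrow> ?star")
proof
  assume "contains_star G n"
  then obtain H where H: "complete_bipartite_digraph 1 n (with_proj H)"
    and sub: "pverts H \<subseteq> pverts G" "parcs H \<subseteq> parcs G"
    by (auto simp: contains_star_def subgraph_def)
  from H obtain U V where UV: "finite (pverts H)" "pverts H = U \<union> V" "U \<inter> V = {}" "card U = 1"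
    "card V = n" "parcs H = U \<times> V \<union> V \<times> U"
    unfolding complete_bipartite_digraph_pair_def by blast
  from \<open>card U = 1\<close> obtain c where "U = {c}"
    by (rule card_1_singletonE)
  with UV sub show ?star
    by (intro exI[of _ c] exI[of _ V]) auto
next
  assume ?star
  then obtain c V where cV: "c \<notin> V" "finite V" "card V = n" "c \<in> pverts G" "V \<subseteq> pverts G"
    "{c} \<times> V \<union> V \<times> {c} \<subseteq> parcs G"
    by blast
  interpret pair_wf_digraph G by fact
  let ?H = "\<lparr>pverts = {c} \<union> V, parcs = {c} \<times> V \<union> V \<times> {c}\<rparr>"
  have H: "complete_bipartite_digraph 1 n (with_proj ?H)"
    unfolding complete_bipartite_digraph_pair_def using cV
    by (intro conjI exI[of _ "{c}"] exI[of _ V]) auto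
  then have "wf_digraph (with_proj ?H)"
    by (simp add: complete_bipartite_digraph_def graph_def digraph_def fin_digraph_def)
  with cV have "subgraph (with_proj ?H) (with_proj G)"
    by (auto simp: subgraph_def wf_digraph)
  with H show "contains_star G n"
    unfolding contains_star_def by blast
qed

section \<open>The upper bound\<close>

text \<open>
  By integrality and \<open>vdist_arc_le\<close>, the distance of an edge at \<open>c\<close> to \<open>s\<close> is determined by whether it
  is smaller than that of \<open>c\<close>.
\<close>

lemma (in pair_wf_digraph) edge_dist_eq_if_both_closer:
  assumes "(c, v) \<in> parcs G" "(c, w) \<in> parcs G"
    and closer: "edge_dist G {c, v} s < vdist G c s \<longleftrightarrow> edge_dist G {c, w} s < vdist G c s"
  shows "edge_dist G {c, v} s = edge_dist G {c, w} s"
proof -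
  have pred: "edge_dist G {c, x} s + 1 = vdist G c s"
    if "(c, x) \<in> parcs G" "edge_dist G {c, x} s < vdist G c s" for x
  proof -
    from that(2) have *: "vdist G x s < vdist G c s" "edge_dist G {c, x} s = vdist G x s"
      by (auto simp: edge_dist_doubleton min_def split: if_splits)
    then show ?thesis
      using vdist_arc_le[OF that(1), of s]
      by (cases rule: vdist_cases[of c s]; cases rule: vdist_cases[of x s]) auto
  qed
  show ?thesis
  proof (cases "edge_dist G {c, v} s < vdist G c s")
    case True
    with closer pred assms(1,2)
    have "edge_dist G {c, v} s + 1 = edge_dist G {c, w} s + 1"
      by simp
    then show ?thesis
      by (cases "edge_dist G {c, v} s"; cases "edge_dist G {c, w} s") auto
  next
    case False
    with closer show ?thesis
      by (simp add: edge_dist_doubleton min_def split: if_splits)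
  qed
qed

lemma (in pair_wf_digraph) star_leaves_le:
  assumes S: "edge_resolving G S" "finite S"
    and star: "\<And>v. v \<in> V \<Longrightarrow> (c, v) \<in> parcs G" "c \<notin> V"
  shows "card V \<le> 2 ^ card S"
proof -
  let ?code = "\<lambda>v. {s \<in> S. edge_dist G {c, v} s < vdist G c s}"
  have "inj_on ?code V"
  proof (rule inj_onI)
    fix v w assume vw: "v \<in> V" "w \<in> V" and eq: "?code v = ?code w"
    have "edge_dist G {c, v} s = edge_dist G {c, w} s" if "s \<in> S" for s
      using eq that vw star(1) by (intro edge_dist_eq_if_both_closer) auto
    moreover have "{c, v} \<in> uedges G" "{c, w} \<in> uedges G"
      using vw star(1) by (auto simp: uedges_def)
    ultimately have "{c, v} = {c, w}"
      by (intro edge_resolvingD[OF S(1)])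
    then show "v = w"
      using vw star(2) by (auto simp: doubleton_eq_iff)
  qed
  then have "card V \<le> card (Pow S)"
    using \<open>finite S\<close> by (intro card_inj_on_le[of ?code]) auto
  then show ?thesis
    using \<open>finite S\<close> by (simp add: card_Pow)
qed

section \<open>A graph attaining the bound\<close>

text \<open>
  The \<open>k\<close>-bit strings are the numbers below \<open>2 ^ k\<close>, the landmark of bit \<open>i < k\<close> is \<open>2 ^ k + i\<close>, and
  \<open>2 ^ k + k\<close> is the centre of the star.
\<close>

definition bit_links :: "nat \<Rightarrow> (nat \<times> nat) set" where
  "bit_links k = {(2 ^ k + i, b) | i b. i \<le> k \<and> b < 2 ^ k \<and> (i < k \<longrightarrow> bit b i)}"

definition bit_graph :: "nat \<Rightarrow> nat pair_pre_digraph" where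
  "bit_graph k = \<lparr>pverts = {..2 ^ k + k}, parcs = bit_links k \<union> (bit_links k)\<inverse>\<rparr>"

lemma bit_graph_simps [simp]:
  "pverts (bit_graph k) = {..2 ^ k + k}"
  "parcs (bit_graph k) = bit_links k \<union> (bit_links k)\<inverse>"
  by (simp_all add: bit_graph_def)

lemma uedges_bit_graph: "uedges (bit_graph k) = {{x, b} | x b. (x, b) \<in> bit_links k}"
  unfolding uedges_def by (auto simp: insert_commute)

lemma bit_links_bounds: "(x, b) \<in> bit_links k \<Longrightarrow> b < 2 ^ k \<and> 2 ^ k \<le> x \<and> x \<le> 2 ^ k + k"
  by (auto simp: bit_links_def)

lemma pair_graph_bit_graph: "pair_graph (bit_graph k)"
proof
  have "bit_links k \<subseteq> {..2 ^ k + k} \<times> {..2 ^ k + k}"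
    by (auto dest: bit_links_bounds)
  then have "finite (bit_links k)"
    by (rule finite_subset) simp
  then show "finite (parcs (bit_graph k))"
    by simp
  show "symmetric (with_proj (bit_graph k))"
    by (auto simp: symmetric_def intro: symI)
qed (auto dest: bit_links_bounds)

text \<open>
  The graph is bipartite. Any two of the landmarks and the centre have the all-ones string \<open>mask k\<close> as a
  common neighbour, so a string without bit \<open>i\<close> reaches the landmark of \<open>i\<close> in three steps.
\<close>

lemma vdist_bit_graph:
  assumes i: "i < k" and x: "x \<le> 2 ^ k + k"
  shows "vdist (bit_graph k) x (2 ^ k + i) =
    (if x = 2 ^ k + i then 0 else if 2 ^ k \<le> x then 2 else if bit x i then 1 else 3)"
proof -
  interpret pair_graph "bit_graph k" by (rule pair_graph_bit_graph)
  let ?s = "2 ^ k + i"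
  define \<phi> :: "nat \<Rightarrow> nat" where
    "\<phi> x = (if x = ?s then 0 else if 2 ^ k \<le> x then 2 else if bit x i then 1 else 3)" for x
  have "vdist (bit_graph k) x ?s = ereal (real (\<phi> x))"
  proof (rule vdist_eq_potential)
    fix x y assume "(x, y) \<in> parcs (bit_graph k)"
    then show "\<phi> x \<le> \<phi> y + 1"
      using i by (auto simp: \<phi>_def bit_links_def)
  next
    fix x assume "x \<in> pverts (bit_graph k)" and "x \<noteq> ?s"
    then consider (upper) j where "j \<le> k" "x = 2 ^ k + j" | (set) "x < 2 ^ k" "bit x i"
      | (unset) "x < 2 ^ k" "\<not> bit x i"
      by (metis add_le_cancel_left atMost_iff bit_graph_simps(1) le_Suc_ex linorder_not_less)
    then show "\<exists>y. (x, y) \<in> parcs (bit_graph k) \<and> \<phi> x = \<phi> y + 1"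
    proof cases
      case upper
      obtain m :: nat where m: "m < 2 ^ k" "\<And>j. j < k \<Longrightarrow> bit m j"
        by (rule that[of "mask k"]) (simp add: mask_eq_exp_minus_1, simp add: bit_mask_iff)
      with upper show ?thesis
        using i \<open>x \<noteq> ?s\<close> by (intro exI[of _ m]) (auto simp: \<phi>_def bit_links_def)
    next
      case set
      then show ?thesis
        using i by (intro exI[of _ ?s]) (auto simp: \<phi>_def bit_links_def)
    next
      case unset
      then show ?thesis
        using i by (intro exI[of _ "2 ^ k + k"]) (auto simp: \<phi>_def bit_links_def)
    qed
  qed (use i x in \<open>auto simp: \<phi>_def\<close>)
  then show ?thesis
    by (auto simp: \<phi>_def)
qed

lemma edge_dist_bit_graph:
  assumes "(x, b) \<in> bit_links k" "i < k"
  shows "edge_dist (bit_graph k) {x, b} (2 ^ k + i) =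
    (if x = 2 ^ k + i then 0 else if bit b i then 1 else 2)"
  using assms bit_links_bounds[OF assms(1)]
  by (auto simp: edge_dist_doubleton vdist_bit_graph min_def)

lemma edge_resolving_bit_graph: "edge_resolving (bit_graph k) {2 ^ k..<2 ^ k + k}"
proof -
  have "x = y \<and> b = b'"
    if links: "(x, b) \<in> bit_links k" "(y, b') \<in> bit_links k"
      and eq: "\<And>s. s \<in> {2 ^ k..<2 ^ k + k} \<Longrightarrow>
        edge_dist (bit_graph k) {x, b} s = edge_dist (bit_graph k) {y, b'} s" for x y b b'
  proof
    have eq: "(if x = 2 ^ k + i then 0 else if bit b i then 1 else 2 :: ereal) =
        (if y = 2 ^ k + i then 0 else if bit b' i then 1 else 2)" if "i < k" for i
      using eq[of "2 ^ k + i"] that links by (simp add: edge_dist_bit_graph)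
    have "x = 2 ^ k + i \<longleftrightarrow> y = 2 ^ k + i" if "i < k" for i
      using eq[OF that] by (auto split: if_splits)
    then show "x = y"
      using links unfolding bit_links_def by (smt (verit) Pair_inject le_neq_implies_less mem_Collect_eq)
    show "b = b'"
    proof (rule bit_eqI)
      fix i
      show "bit b i \<longleftrightarrow> bit b' i"
      proof (cases "i < k")
        case True
        \<comment> \<open>Where the distance is 0 it says nothing about the strings, but there both bits are set.\<close>
        with eq[OF True] links \<open>x = y\<close> show ?thesis
          by (auto simp: bit_links_def split: if_splits)
      next
        case False
        with bit_links_bounds links have "take_bit k b = b" "take_bit k b' = b'"
          by (auto simp: take_bit_nat_eq_self_iff)
        with False show ?thesis
          by (metis bit_take_bit_iff)
      qed
    qed
  qed
  then show ?thesis
    unfolding edge_resolving_def uedges_bit_graph by (auto simp: subset_iff)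
qed

lemma connected_bit_graph:
  assumes "k \<ge> 1"
  shows "connected (with_proj (bit_graph k))"
proof -
  interpret pair_graph "bit_graph k" by (rule pair_graph_bit_graph)
  have to_landmark: "x \<rightarrow>\<^sup>*\<^bsub>with_proj (bit_graph k)\<^esub> (2 ^ k)" if "x \<le> 2 ^ k + k" for x
    using vdist_bit_graph[of 0 k x] that assms
    by (auto simp: vdist_def simp flip: \<mu>_reach_conv[of "\<lambda>_. 1"])
  have "x \<rightarrow>\<^sup>*\<^bsub>with_proj (bit_graph k)\<^esub> y" if "x \<le> 2 ^ k + k" "y \<le> 2 ^ k + k" for x y
    using to_landmark[OF that(1)] symmetric_reachable'[OF to_landmark[OF that(2)]]
    by (rule reachable_trans)
  then show ?thesis
    unfolding connected_def
    by (intro strongly_connectedI) (auto simp: reachable_mk_symmetric_eq[OF pair_sym_arcs])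
qed

lemma contains_star_bit_graph: "contains_star (bit_graph k) (2 ^ k)"
proof -
  interpret pair_graph "bit_graph k" by (rule pair_graph_bit_graph)
  have "{2 ^ k + k} \<times> {..<2 ^ k} \<subseteq> bit_links k"
    by (auto simp: bit_links_def)
  then show ?thesis
    by (subst contains_star_iff, unfold_locales)
      (auto intro!: exI[of _ "2 ^ k + k"] exI[of _ "{..<2 ^ k}"])
qed

section \<open>The maximal star\<close>

theorem theorem3p2:
  fixes k :: nat
  assumes "k \<ge> 1"
  shows "(\<exists>G :: nat pair_pre_digraph.
            pair_graph G \<and> connected (with_proj G) \<and> edim G \<le> enat k \<and> contains_star G (2 ^ k))
       \<and> (\<forall>(G :: 'a pair_pre_digraph) n.
            pair_bidirected_digraph G \<and> connected (with_proj G) \<and> edim G \<le> enat k \<and> contains_star G n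
            \<longrightarrow> n \<le> 2 ^ k)"
proof (intro conjI allI impI; (elim conjE)?)
  show "\<exists>G :: nat pair_pre_digraph.
      pair_graph G \<and> connected (with_proj G) \<and> edim G \<le> enat k \<and> contains_star G (2 ^ k)"
    using pair_graph_bit_graph connected_bit_graph[OF assms] contains_star_bit_graph
      edim_le_card[OF edge_resolving_bit_graph, of k] by auto
next
  fix G :: "'a pair_pre_digraph" and n
  assume "pair_bidirected_digraph G" "edim G \<le> enat k" "contains_star G n"
  interpret pair_bidirected_digraph G by fact
  obtain S where S: "edge_resolving G S" "finite S" "card S \<le> k"
    using \<open>edim G \<le> enat k\<close> by (rule edim_leE)
  obtain c V where "c \<notin> V" "card V = n" "{c} \<times> V \<subseteq> parcs G"
    using \<open>contains_star G n\<close> unfolding contains_star_iff[OF pair_wf_digraph_axioms] by auto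
  then have "n \<le> 2 ^ card S"
    using star_leaves_le[OF S(1,2), of V c] by auto
  also have "\<dots> \<le> 2 ^ k"
    using S(3) by simp
  finally show "n \<le> 2 ^ k" .
qed

end
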